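(* If $X$ is a (Hausdorff) topological group, then $X$ is strongly rectifiable. If $X$ is a (Hausdorff) precompact topological group, then $X$ is precompact strongly rectifiable.
   Context: A space $X$ is strongly rectifiable if there exists a strong Mal'tsev operation on $X$, i.e. a continuous map $P:X^3\to X$ such that $P(x,y,y)=P(y,y,x)=x$ and $P(x,y,P(y,z,u))=P(x,z,u)$ for all $x,y,z,u\in X$. A continuous operation $P:X^3\to X$ with $P(x,y,y)=P(y,y,x)=x$ is called precompact if there is a Hausdorff compact extension $bX$ of $X$ (a compact Hausdorff space containing $X$ as a dense subspace) such that $P$ extends to a continuous map $bX^3\to bX$. A space $X$ is precompact strongly rectifiable if there exists a continuous precompact strong Mal'tsev operation on $X$. A topological group is precompact if for each neighbourhood $U$ of the identity finitely many translates of $U$ cover the group. *)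

theory Defs
  imports "HOL-Analysis.Analysis"
begin

definition cube_topology :: "'a topology \<Rightarrow> ('a \<times> 'a \<times> 'a) topology" where
  "cube_topology X = prod_topology X (prod_topology X X)"

definition continuous_ternary :: "'a topology \<Rightarrow> ('a \<Rightarrow> 'a \<Rightarrow> 'a \<Rightarrow> 'a) \<Rightarrow> bool" where
  "continuous_ternary X P \<longleftrightarrow> continuous_map (cube_topology X) X (\<lambda>(x, y, z). P x y z)"

definition maltsev_operation :: "'a topology \<Rightarrow> ('a \<Rightarrow> 'a \<Rightarrow> 'a \<Rightarrow> 'a) \<Rightarrow> bool" where
  "maltsev_operation X P \<longleftrightarrow>
     continuous_ternary X P \<and>
     (\<forall>x\<in>topspace X. \<forall>y\<in>topspace X. P x y y = x \<and> P y y x = x)"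

definition strong_maltsev_operation :: "'a topology \<Rightarrow> ('a \<Rightarrow> 'a \<Rightarrow> 'a \<Rightarrow> 'a) \<Rightarrow> bool" where
  "strong_maltsev_operation X P \<longleftrightarrow>
     maltsev_operation X P \<and>
     (\<forall>x\<in>topspace X. \<forall>y\<in>topspace X. \<forall>z\<in>topspace X. \<forall>u\<in>topspace X.
        P x y (P y z u) = P x z u)"

definition strongly_rectifiable :: "'a topology \<Rightarrow> bool" where
  "strongly_rectifiable X \<longleftrightarrow> (\<exists>P. strong_maltsev_operation X P)"

definition compact_extension :: "'a topology \<Rightarrow> 'b topology \<Rightarrow> ('a \<Rightarrow> 'b) \<Rightarrow> bool" where
  "compact_extension X B e \<longleftrightarrow>
     compact_space B \<and> Hausdorff_space B \<and> embedding_map X B e \<and>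
     B closure_of (e ` topspace X) = topspace B"

definition extends_to :: "'a topology \<Rightarrow> ('a \<Rightarrow> 'a \<Rightarrow> 'a \<Rightarrow> 'a) \<Rightarrow> 'b topology \<Rightarrow> ('a \<Rightarrow> 'b) \<Rightarrow> bool" where
  "extends_to X P B e \<longleftrightarrow>
     (\<exists>Q. continuous_ternary B Q \<and>
        (\<forall>x\<in>topspace X. \<forall>y\<in>topspace X. \<forall>z\<in>topspace X. Q (e x) (e y) (e z) = e (P x y z)))"

text \<open>HOL cannot quantify over the type of points of the extension. Since a Hausdorff space
  with a dense subset \<open>D\<close> has at most as many points as \<open>Pow (Pow D)\<close>, the type
  \<open>'a set set\<close> is large enough: lemma \<open>precompact_operationI\<close> below shows that extensions of
  an arbitrary type give nothing more.\<close>

definition precompact_operation :: "'a topology \<Rightarrow> ('a \<Rightarrow> 'a \<Rightarrow> 'a \<Rightarrow> 'a) \<Rightarrow> bool" where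
  "precompact_operation X P \<longleftrightarrow>
     maltsev_operation X P \<and>
     (\<exists>(B :: 'a set set topology) e. compact_extension X B e \<and> extends_to X P B e)"

definition precompact_strongly_rectifiable :: "'a topology \<Rightarrow> bool" where
  "precompact_strongly_rectifiable X \<longleftrightarrow>
     (\<exists>P. strong_maltsev_operation X P \<and> precompact_operation X P)"

text \<open>Left translates; using right translates gives the same notion, by applying \<open>uminus\<close>.\<close>

definition precompact_group :: "'a::topological_group_add itself \<Rightarrow> bool" where
  "precompact_group _ \<longleftrightarrow>
     (\<forall>U :: 'a set. (\<forall>\<^sub>F x in nhds 0. x \<in> U) \<longrightarrow>
        (\<exists>F. finite F \<and> (\<Union>g\<in>F. (\<lambda>x. g + x) ` U) = UNIV))"

lemma compact_extension_image:
  assumes "compact_extension X B e"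
  shows "e ` topspace X \<subseteq> topspace B"
proof -
  have "homeomorphic_map X (subtopology B (e ` topspace X)) e"
    using assms unfolding compact_extension_def embedding_map_def by blast
  from homeomorphic_imp_surjective_map[OF this] show ?thesis
    unfolding topspace_subtopology by blast
qed

lemma compact_extension_homeomorphic:
  assumes "compact_extension X B e" "homeomorphic_maps B C f g"
  shows "compact_extension X C (f \<circ> e)"
proof -
  have hm: "homeomorphic_map B C f"
    using assms(2) homeomorphic_maps_map by blast
  have hs: "B homeomorphic_space C"
    using assms(2) homeomorphic_space_def by blast
  have sub: "e ` topspace X \<subseteq> topspace B"
    by (rule compact_extension_image[OF assms(1)])
  have "C closure_of (f ` (e ` topspace X)) = f ` (B closure_of (e ` topspace X))"
    by (rule homeomorphic_map_closure_of[OF hm sub])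
  then have "C closure_of ((f \<circ> e) ` topspace X) = topspace C"
    using assms(1) homeomorphic_imp_surjective_map[OF hm]
    unfolding compact_extension_def by (simp add: image_comp)
  moreover have "compact_space C"
    using assms(1) homeomorphic_compact_space[OF hs] unfolding compact_extension_def by simp
  moreover have "Hausdorff_space C"
    using assms(1) homeomorphic_Hausdorff_space[OF hs] unfolding compact_extension_def by simp
  moreover have "embedding_map X C (f \<circ> e)"
  proof (rule embedding_map_compose)
    show "embedding_map X B e" using assms(1) unfolding compact_extension_def by blast
    show "embedding_map B C f"
      unfolding embedding_map_def homeomorphic_imp_surjective_map[OF hm] subtopology_topspace
      by (rule hm)
  qed
  ultimately show ?thesis
    unfolding compact_extension_def by blast
qed

lemma extends_to_homeomorphic:
  assumes e: "e ` topspace X \<subseteq> topspace B"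
    and "extends_to X P B e" "homeomorphic_maps B C f g"
  shows "extends_to X P C (f \<circ> e)"
proof -
  obtain Q where Q: "continuous_ternary B Q"
    and QP: "\<And>x y z. \<lbrakk>x \<in> topspace X; y \<in> topspace X; z \<in> topspace X\<rbrakk>
               \<Longrightarrow> Q (e x) (e y) (e z) = e (P x y z)"
    using assms(2) unfolding extends_to_def by blast
  have cf: "continuous_map B C f" and cg: "continuous_map C B g"
    and gf: "\<And>x. x \<in> topspace B \<Longrightarrow> g (f x) = x"
    using assms(3) by (auto simp: homeomorphic_maps_def)
  let ?R = "\<lambda>x y z. f (Q (g x) (g y) (g z))"
  have "continuous_map (cube_topology C) (cube_topology B) (\<lambda>(x, y, z). (g x, g y, g z))"
    unfolding cube_topology_def case_prod_unfold
    using cg by (intro continuous_map_pairedI continuous_map_compose[OF _ cg, unfolded o_def]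
        continuous_map_fst continuous_map_fst_of[OF continuous_map_snd, unfolded o_def]
        continuous_map_snd_of[OF continuous_map_snd, unfolded o_def])
  then have "continuous_map (cube_topology C) C
      (f \<circ> ((\<lambda>(x, y, z). Q x y z) \<circ> (\<lambda>(x, y, z). (g x, g y, g z))))"
    using Q cf unfolding continuous_ternary_def by (intro continuous_map_compose)
  moreover have "f \<circ> ((\<lambda>(x, y, z). Q x y z) \<circ> (\<lambda>(x, y, z). (g x, g y, g z))) = (\<lambda>(x, y, z). ?R x y z)"
    by auto
  ultimately have "continuous_ternary C ?R"
    unfolding continuous_ternary_def by (simp only:)
  moreover have "?R ((f \<circ> e) x) ((f \<circ> e) y) ((f \<circ> e) z) = (f \<circ> e) (P x y z)"
    if "x \<in> topspace X" "y \<in> topspace X" "z \<in> topspace X" for x y z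
  proof -
    have "e x \<in> topspace B" "e y \<in> topspace B" "e z \<in> topspace B"
      using that e by auto
    then show ?thesis using that QP by (simp add: gf)
  qed
  ultimately show ?thesis unfolding extends_to_def by blast
qed

lemma ex_homeomorphic_set_set:
  fixes X :: "'a topology" and B :: "'b topology"
  assumes "compact_extension X B e"
  shows "\<exists>(C :: 'a set set topology) f g. homeomorphic_maps B C f g"
proof -
  define f where "f y = {{x \<in> topspace X. e x \<in> U} | U. openin B U \<and> y \<in> U}" for y
  have "inj_on f (topspace B)"
  proof (rule inj_onI, rule ccontr)
    fix y z assume yz: "y \<in> topspace B" "z \<in> topspace B" "f y = f z" "y \<noteq> z"
    obtain U V where UV: "openin B U" "openin B V" "y \<in> U" "z \<in> V" "disjnt U V"
      using assms yz unfolding compact_extension_def Hausdorff_space_def by metis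
    have "{x \<in> topspace X. e x \<in> U} \<in> f z"
      using UV yz(3) unfolding f_def by blast
    then obtain W where W: "openin B W" "z \<in> W"
      and eq: "{x \<in> topspace X. e x \<in> U} = {x \<in> topspace X. e x \<in> W}"
      unfolding f_def by blast
    have "z \<in> B closure_of (e ` topspace X)"
      using assms yz(2) unfolding compact_extension_def by simp
    moreover have "openin B (V \<inter> W)" "z \<in> V \<inter> W" using UV W by auto
    ultimately obtain x where "x \<in> topspace X" "e x \<in> V \<inter> W"
      unfolding in_closure_of by blast
    then show False using eq UV(5) unfolding disjnt_def by blast
  qed
  define g where "g = inv_into (topspace B) f"
  define C where "C = pullback_topology (f ` topspace B) g B"
  have gf: "g (f y) = y" if "y \<in> topspace B" for y
    unfolding g_def using that \<open>inj_on f (topspace B)\<close> by simp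
  have tC: "topspace C = f ` topspace B"
    unfolding C_def topspace_pullback_topology using gf by auto
  have "continuous_map C B g"
    unfolding C_def
    using continuous_map_pullback[OF continuous_map_id] unfolding id_comp .
  moreover have "continuous_map B C f"
    unfolding C_def
  proof (rule continuous_map_pullback')
    show "continuous_map B B (g \<circ> f)"
      by (rule continuous_map_eq[OF continuous_map_id]) (simp add: gf)
  qed auto
  ultimately have "homeomorphic_maps B C f g"
    unfolding homeomorphic_maps_def using tC gf by auto
  then show ?thesis by blast
qed

lemma precompact_operationI:
  fixes X :: "'a topology" and B :: "'b topology"
  assumes P: "maltsev_operation X P" and B: "compact_extension X B e" and PB: "extends_to X P B e"
  shows "precompact_operation X P"
proof -
  obtain C :: "'a set set topology" and f g where fg: "homeomorphic_maps B C f g"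
    using ex_homeomorphic_set_set[OF B] by blast
  have e: "e ` topspace X \<subseteq> topspace B"
    by (rule compact_extension_image[OF B])
  show ?thesis
    using P compact_extension_homeomorphic[OF B fg] extends_to_homeomorphic[OF e PB fg]
    unfolding precompact_operation_def by blast
qed

end

theory Submission
  imports Defs
begin

text \<open>
  The operation is \<open>x - y + z\<close>. If the group is precompact, then conjugation is uniformly small
  near \<open>0\<close>, every ultrafilter is Cauchy, and the points of the compact extension are the minimal
  Cauchy filters, that is, the Cauchy filters in which every member is a uniform neighbourhood of
  another member; a group element \<open>x\<close> corresponds to \<open>nhds x\<close>. The image of three minimal
  Cauchy filters under \<open>x - y + z\<close> is again one, and this image filter is the value of the
  extended operation.
\<close>

section \<open>The Mal'tsev operation of a topological group\<close>

definition group_maltsev :: "'a::group_add \<Rightarrow> 'a \<Rightarrow> 'a \<Rightarrow> 'a" where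
  "group_maltsev x y z = x - y + z"

lemma tendsto_group_maltsev:
  fixes f g h :: "'b \<Rightarrow> 'a::topological_group_add"
  assumes "(f \<longlongrightarrow> a) F" "(g \<longlongrightarrow> b) F" "(h \<longlongrightarrow> c) F"
  shows "((\<lambda>t. group_maltsev (f t) (g t) (h t)) \<longlongrightarrow> group_maltsev a b c) F"
  unfolding group_maltsev_def by (intro tendsto_intros assms)

lemma strong_maltsev_group_maltsev:
  "strong_maltsev_operation (euclidean :: 'a::topological_group_add topology) group_maltsev"
proof -
  have "continuous_on UNIV (\<lambda>(x, y, z). group_maltsev x y (z::'a))"
    unfolding continuous_on_def case_prod_unfold
    by (intro ballI tendsto_group_maltsev tendsto_fst tendsto_snd tendsto_ident_at)
  then have "continuous_ternary (euclidean :: 'a topology) group_maltsev"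
    unfolding continuous_ternary_def cube_topology_def by simp
  moreover have "group_maltsev x y (group_maltsev y z u) = group_maltsev x z u" for x y z u :: 'a
    unfolding group_maltsev_def by (simp add: diff_conv_add_uminus add.assoc del: add_uminus_conv_diff)
  ultimately show ?thesis
    unfolding strong_maltsev_operation_def maltsev_operation_def
    by (auto simp: group_maltsev_def)
qed

text \<open>Together with \<open>filterlim_ident\<close> these two rules settle, by repeated
  resolution, every goal saying that an iterated projection from a product filter tends to the
  corresponding factor.\<close>

lemma filterlim_fst_of: "filterlim f (F \<times>\<^sub>F G) H \<Longrightarrow> filterlim (\<lambda>t. fst (f t)) F H"
  by (rule filterlim_compose[OF filterlim_fst])

lemma filterlim_snd_of: "filterlim f (F \<times>\<^sub>F G) H \<Longrightarrow> filterlim (\<lambda>t. snd (f t)) G H"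
  by (rule filterlim_compose[OF filterlim_snd])

lemmas filterlim_projs = filterlim_fst_of filterlim_snd_of filterlim_ident

subsection \<open>Ultrafilters\<close>

definition ultrafilter :: "'a filter \<Rightarrow> bool" where
  "ultrafilter F \<longleftrightarrow> F \<noteq> bot \<and> (\<forall>P. eventually P F \<or> eventually (\<lambda>x. \<not> P x) F)"

lemma ultrafilter_not_bot: "ultrafilter F \<Longrightarrow> F \<noteq> bot"
  unfolding ultrafilter_def by blast

lemma ultrafilter_eventually_ex_finite:
  assumes "ultrafilter F" "finite I" "eventually (\<lambda>x. \<exists>i\<in>I. P i x) F"
  shows "\<exists>i\<in>I. eventually (P i) F"
proof (rule ccontr)
  assume "\<not> ?thesis"
  then have "\<forall>i\<in>I. eventually (\<lambda>x. \<not> P i x) F"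
    using assms(1) unfolding ultrafilter_def by blast
  then have "eventually (\<lambda>x. \<forall>i\<in>I. \<not> P i x) F"
    using assms(2) by (simp add: eventually_ball_finite)
  with assms(3) have "eventually (\<lambda>x. False) F"
    by eventually_elim blast
  then show False
    using assms(1) unfolding ultrafilter_def by (simp add: eventually_False)
qed

text \<open>Zorn's lemma is applied to the proper filters below \<open>F\<close> with the order
  reversed, since finer filters are smaller. A minimal proper filter decides every predicate,
  because adjoining a predicate compatible with it changes nothing.\<close>

lemma ex_ultrafilter_le:
  fixes F :: "'a filter"
  assumes "F \<noteq> bot"
  shows "\<exists>G. ultrafilter G \<and> G \<le> F"
proof -
  define S where "S = {G. G \<le> F \<and> G \<noteq> bot}"
  have "\<exists>m\<in>S. \<forall>a\<in>S. a \<le> m \<longrightarrow> a = m"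
  proof (rule predicate_Zorn[where P = "\<lambda>x y. y \<le> x"])
    show "partial_order_on S (relation_of (\<lambda>x y. y \<le> x) S)"
      by (rule partial_order_on_relation_ofI) auto
    fix C assume "C \<in> Chains (relation_of (\<lambda>x y. y \<le> x) S)"
    then have CS: "C \<subseteq> S" and chain: "\<And>a b. \<lbrakk>a \<in> C; b \<in> C\<rbrakk> \<Longrightarrow> a \<le> b \<or> b \<le> a"
      unfolding Chains_def relation_of_def by blast+
    show "\<exists>u\<in>S. \<forall>a\<in>C. u \<le> a"
    proof (cases "C = {}")
      case True
      then show ?thesis using assms unfolding S_def by blast
    next
      case False
      \<comment> \<open>Properness of an infimum is tested on finite subfamilies, and in a chain the
        infimum of a nonempty finite subfamily is one of its members.\<close>
      have "Inf X \<noteq> bot" if "finite X" "X \<subseteq> C" for X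
      proof (cases "X = {}")
        case True
        then show ?thesis using assms top_unique[of F] by auto
      next
        case False
        have "Inf X \<in> X" using \<open>finite X\<close> False \<open>X \<subseteq> C\<close>
        proof (induction X rule: finite_ne_induct)
          case (insert x X)
          then have "x \<le> Inf X \<or> Inf X \<le> x" using chain by blast
          then show ?case using insert by (auto simp: inf_absorb1 inf_absorb2)
        qed auto
        then show ?thesis using that CS unfolding S_def by blast
      qed
      then have "Inf C \<noteq> bot" by (rule Inf_filter_not_bot)
      moreover have "Inf C \<le> F"
      proof -
        obtain G where G: "G \<in> C" using False by blast
        then have "G \<le> F" using CS unfolding S_def by blast
        with G show ?thesis by (rule Inf_lower2)
      qed
      ultimately show ?thesis unfolding S_def by (auto intro: Inf_lower)
    qed
  qed
  then obtain G where "G \<in> S" and min_S: "\<And>H. \<lbrakk>H \<in> S; H \<le> G\<rbrakk> \<Longrightarrow> H = G" by blast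
  then have G: "G \<le> F" "G \<noteq> bot" unfolding S_def by auto
  have min: "H = G" if "H \<le> G" "H \<noteq> bot" for H
    using min_S[of H] that G(1) order_trans unfolding S_def by blast
  have "eventually P G" if "\<not> eventually (\<lambda>x. \<not> P x) G" for P
  proof -
    have "inf G (principal {x. P x}) \<noteq> bot"
      using that unfolding trivial_limit_def eventually_inf_principal by simp
    then have "inf G (principal {x. P x}) = G" using min by simp
    moreover have "eventually P (inf G (principal {x. P x}))"
      unfolding eventually_inf_principal by simp
    ultimately show ?thesis by simp
  qed
  then show ?thesis using G unfolding ultrafilter_def by blast
qed

subsection \<open>Minimal Cauchy filters\<close>

text \<open>Cauchy for the left uniformity, whose entourages are given by the pairs with
  \<open>- x + y\<close> in a neighbourhood of 0.\<close>

definition left_cauchy :: "'a::topological_group_add filter \<Rightarrow> bool" where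
  "left_cauchy F \<longleftrightarrow> ((\<lambda>(x, y). - x + y) \<longlongrightarrow> 0) (F \<times>\<^sub>F F)"

text \<open>Generated by the sets C + V with C in \<open>F\<close> and V a neighbourhood of 0, that
  is, by the left uniform neighbourhoods of the members of \<open>F\<close>.\<close>

definition thicken :: "'a::topological_group_add filter \<Rightarrow> 'a filter" where
  "thicken F = filtermap (\<lambda>(x, v). x + v) (F \<times>\<^sub>F nhds 0)"

text \<open>By \<open>le_thicken\<close> the last condition amounts to \<open>thicken F = F\<close>.
  Minimality refers to inclusion of the families of members; in the order of filters these are the
  maximal proper Cauchy filters.\<close>

definition min_cauchy :: "'a::topological_group_add filter set" where
  "min_cauchy = {F. F \<noteq> bot \<and> left_cauchy F \<and> thicken F \<le> F}"

lemma min_cauchy_not_bot: "F \<in> min_cauchy \<Longrightarrow> F \<noteq> bot"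
  unfolding min_cauchy_def by blast

lemma left_cauchyD:
  assumes "left_cauchy F" "eventually (\<lambda>v. v \<in> V) (nhds 0)"
  shows "\<exists>D. eventually (\<lambda>x. x \<in> D) F \<and> (\<forall>x\<in>D. \<forall>y\<in>D. - x + y \<in> V)"
proof -
  have "eventually (\<lambda>(x, y). - x + y \<in> V) (F \<times>\<^sub>F F)"
    using assms unfolding left_cauchy_def filterlim_iff by (auto simp: case_prod_unfold)
  then obtain P where "eventually P F" "\<forall>x y. P x \<longrightarrow> P y \<longrightarrow> - x + y \<in> V"
    unfolding eventually_prod_same by auto
  then show ?thesis by (intro exI[of _ "Collect P"]) auto
qed

text \<open>Used to estimate differences of corresponding coordinates along a product of several
  filters.\<close>

lemma left_cauchy_tendsto:
  assumes "left_cauchy F" "filterlim f F H" "filterlim g F H"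
  shows "((\<lambda>t. - f t + g t) \<longlongrightarrow> 0) H"
  using filterlim_compose[OF assms(1)[unfolded left_cauchy_def] filterlim_Pair[OF assms(2,3)]]
  by simp

lemma left_cauchy_filtermap:
  "left_cauchy (filtermap f F) \<longleftrightarrow> ((\<lambda>(s, t). - f s + f t) \<longlongrightarrow> 0) (F \<times>\<^sub>F F)"
  unfolding left_cauchy_def prod_filtermap1 prod_filtermap2 filtermap_filtermap filterlim_filtermap
  by (simp add: case_prod_unfold)

lemma eventually_thicken:
  "eventually P (thicken F) \<longleftrightarrow>
    (\<exists>C V. eventually C F \<and> eventually V (nhds 0) \<and> (\<forall>x v. C x \<longrightarrow> V v \<longrightarrow> P (x + v)))"
  unfolding thicken_def eventually_filtermap eventually_prod_filter by auto

lemma thicken_mono: "F \<le> G \<Longrightarrow> thicken F \<le> thicken G"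
  unfolding thicken_def by (intro filtermap_mono prod_filter_mono order_refl)

lemma le_thicken: "F \<le> thicken F"
proof (rule filter_leI)
  fix P assume "eventually P (thicken F)"
  then obtain C V where CV: "eventually C F" "eventually V (nhds 0)" "\<forall>x v. C x \<longrightarrow> V v \<longrightarrow> P (x + v)"
    unfolding eventually_thicken by blast
  then have "\<forall>x. C x \<longrightarrow> P x" using eventually_nhds_x_imp_x[OF CV(2)] by force
  then show "eventually P F" using CV(1) by (auto elim: eventually_mono)
qed

lemma thicken_thicken_le: "thicken (thicken F) \<le> thicken F"
proof (rule filter_leI)
  fix P assume "eventually P (thicken F)"
  then obtain C V where CV: "eventually C F" "eventually V (nhds 0)" "\<forall>x v. C x \<longrightarrow> V v \<longrightarrow> P (x + v)"
    unfolding eventually_thicken by blast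
  have "((\<lambda>(v, w). v + w) \<longlongrightarrow> (0::'a) + 0) (nhds 0 \<times>\<^sub>F nhds 0)"
    unfolding case_prod_unfold
    by (rule tendsto_add filterlim_projs)+
  then have "eventually (\<lambda>(v, w). V (v + w)) (nhds 0 \<times>\<^sub>F nhds 0)"
    using CV(2) unfolding filterlim_iff by (auto simp: case_prod_unfold)
  then obtain W where W: "eventually W (nhds 0)" "\<forall>v w. W v \<longrightarrow> W w \<longrightarrow> V (v + w)"
    unfolding eventually_prod_same by auto
  \<comment> \<open>The set C + W is a member of \<open>thicken F\<close>, and adding a further
    element of W stays inside C + V.\<close>
  have "eventually (\<lambda>y. \<exists>x v. C x \<and> W v \<and> y = x + v) (thicken F)"
    unfolding eventually_thicken using CV(1) W(1) by blast
  moreover have "P (y + w)" if "\<exists>x v. C x \<and> W v \<and> y = x + v" "W w" for y w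
    using that W(2) CV(3) by (auto simp: add.assoc)
  ultimately show "eventually P (thicken (thicken F))"
    using W(1) unfolding eventually_thicken[of _ "thicken F"] by blast
qed

text \<open>The left difference of \<open>x + v\<close> and \<open>x' + v'\<close> is
  \<open>- v + (- x + x') + v'\<close>. With the small terms added on the right no conjugation
  arises, so this works in every topological group.\<close>

lemma thicken_min_cauchy:
  assumes "F \<noteq> bot" "left_cauchy F"
  shows "thicken F \<in> min_cauchy"
proof -
  have d: "((\<lambda>t. - fst (fst t) + fst (snd t)) \<longlongrightarrow> 0) ((F \<times>\<^sub>F nhds 0) \<times>\<^sub>F (F \<times>\<^sub>F nhds 0))"
    by (rule left_cauchy_tendsto[OF assms(2)] filterlim_projs)+
  have "((\<lambda>t. - snd (fst t) + (- fst (fst t) + fst (snd t)) + snd (snd t)) \<longlongrightarrow> - 0 + 0 + 0)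
      ((F \<times>\<^sub>F nhds 0) \<times>\<^sub>F (F \<times>\<^sub>F nhds 0))"
    by (rule tendsto_add tendsto_minus d filterlim_projs)+
  then have "left_cauchy (thicken F)"
    unfolding thicken_def left_cauchy_filtermap case_prod_unfold
    by (simp add: diff_conv_add_uminus minus_add add.assoc del: add_uminus_conv_diff)
  then show ?thesis
    using assms(1) le_thicken[of F] thicken_thicken_le[of F]
    unfolding min_cauchy_def by (auto simp: le_bot)
qed

text \<open>A minimal Cauchy filter can be recovered from any proper filter finer than it. The main
  point is that a V-small member D of \<open>F\<close> meets every member C of \<open>H\<close> in
  some x, so that D lies in x + V and hence in C + V.\<close>

lemma min_cauchy_eq_thicken:
  assumes "F \<in> min_cauchy" "H \<noteq> bot" "H \<le> F"
  shows "F = thicken H"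
proof (rule antisym)
  have "thicken H \<le> thicken F" by (rule thicken_mono[OF assms(3)])
  also have "\<dots> \<le> F" using assms(1) unfolding min_cauchy_def by blast
  finally show "thicken H \<le> F" .
  show "F \<le> thicken H"
  proof (rule filter_leI)
    fix P assume "eventually P (thicken H)"
    then obtain C V where CV: "eventually C H" "eventually V (nhds 0)"
      "\<forall>x v. C x \<longrightarrow> V v \<longrightarrow> P (x + v)"
      unfolding eventually_thicken by blast
    obtain D where D: "eventually (\<lambda>x. x \<in> D) F" "\<forall>x\<in>D. \<forall>y\<in>D. V (- x + y)"
      using left_cauchyD[of F "Collect V"] assms(1) CV(2) unfolding min_cauchy_def by auto
    have "eventually (\<lambda>x. x \<in> D \<and> C x) H"
      using filter_leD[OF assms(3) D(1)] CV(1) by (rule eventually_conj)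
    then obtain x where x: "x \<in> D" "C x"
      using assms(2) eventually_happens by blast
    have "P y" if "y \<in> D" for y
      using CV(3)[rule_format, of x "- x + y"] D(2) x that by (simp add: add.assoc[symmetric])
    then show "eventually P F" using D(1) by (auto elim: eventually_mono)
  qed
qed

text \<open>Both filters are the thickening of their common refinement
  \<open>inf F G\<close>.\<close>

lemma min_cauchy_eqI:
  assumes "F \<in> min_cauchy" "G \<in> min_cauchy" "inf F G \<noteq> bot"
  shows "F = G"
  using min_cauchy_eq_thicken[OF assms(1,3)] min_cauchy_eq_thicken[OF assms(2,3)] by simp

lemma nhds_min_cauchy: "nhds x \<in> min_cauchy"
proof -
  have "((\<lambda>(x, y). - x + y) \<longlongrightarrow> - x + x) (nhds x \<times>\<^sub>F nhds x)"
    unfolding case_prod_unfold by (rule tendsto_add tendsto_minus filterlim_projs)+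
  moreover have "((\<lambda>(x, v). x + v) \<longlongrightarrow> x + 0) (nhds x \<times>\<^sub>F nhds 0)"
    unfolding case_prod_unfold by (rule tendsto_add filterlim_projs)+
  ultimately show ?thesis
    unfolding min_cauchy_def left_cauchy_def thicken_def by (simp add: filterlim_def)
qed

subsection \<open>Precompact groups\<close>

lemma precompact_groupD:
  assumes "precompact_group TYPE('a::topological_group_add)" "eventually U (nhds (0::'a))"
  shows "\<exists>F. finite F \<and> (\<forall>x. \<exists>g\<in>F. U (- g + x))"
proof -
  obtain F where F: "finite F" "(\<Union>g\<in>F. (\<lambda>x. g + x) ` Collect U) = UNIV"
    using assms(1)[unfolded precompact_group_def, rule_format, of "Collect U"] assms(2) by auto
  have "\<exists>g\<in>F. U (- g + x)" for x
  proof -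
    have "x \<in> (\<Union>g\<in>F. (\<lambda>x. g + x) ` Collect U)" using F(2) by blast
    then obtain g u where "g \<in> F" "U u" "x = g + u" by blast
    then show ?thesis by (intro bexI[of _ g]) (simp_all add: add.assoc[symmetric])
  qed
  then show ?thesis using F(1) by blast
qed

text \<open>Finitely many translates of a small set cover the group, so every x is
  \<open>w - g\<close> with w small and g from a finite set. Conjugation by x is conjugation by one
  of finitely many elements \<open>- g\<close>, each continuous, followed by conjugation by a small
  element, which is controlled by continuity at (0, 0, 0).\<close>

lemma precompact_group_conj_small:
  assumes "precompact_group TYPE('a::topological_group_add)" "eventually U (nhds (0::'a))"
  shows "eventually (\<lambda>v. \<forall>g. U (g + v - g)) (nhds 0)"
proof -
  have "((\<lambda>(w, v, w'). w + v - w') \<longlongrightarrow> (0::'a) + 0 - 0) (nhds 0 \<times>\<^sub>F nhds 0 \<times>\<^sub>F nhds 0)"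
    unfolding case_prod_unfold
    by (rule tendsto_add tendsto_diff filterlim_projs)+
  then have "eventually (\<lambda>(w, v, w'). U (w + v - w')) (nhds 0 \<times>\<^sub>F nhds 0 \<times>\<^sub>F nhds 0)"
    using assms(2) unfolding filterlim_iff by (auto simp: case_prod_unfold)
  then obtain W1 W' where W1: "eventually W1 (nhds 0)" "eventually W' (nhds 0 \<times>\<^sub>F nhds 0)"
    "\<And>w v w'. \<lbrakk>W1 w; W' (v, w')\<rbrakk> \<Longrightarrow> U (w + v - w')"
    unfolding eventually_prod_filter[of _ "nhds 0" "nhds 0 \<times>\<^sub>F nhds 0"] by auto
  obtain W2 where W2: "eventually W2 (nhds 0)" "\<And>v w'. \<lbrakk>W2 v; W2 w'\<rbrakk> \<Longrightarrow> W' (v, w')"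
    using W1(2) unfolding eventually_prod_same by auto
  define W where "W w \<longleftrightarrow> W1 w \<and> W2 w" for w
  have W: "eventually W (nhds 0)" unfolding W_def by (intro eventually_conj W1 W2)
  have WU: "U (w + v - w')" if "W w" "W v" "W w'" for w v w'
    using that W1(3) W2(2) unfolding W_def by blast
  have "((\<lambda>v. - v) \<longlongrightarrow> - (0::'a)) (nhds 0)" by (intro tendsto_minus filterlim_ident)
  then have "eventually (\<lambda>v. W (- v)) (nhds 0)" using W unfolding filterlim_iff by simp
  then obtain F where F: "finite F" "\<And>x. \<exists>g\<in>F. W (- (- g + x))"
    using precompact_groupD[OF assms(1)] by blast
  have "eventually (\<lambda>v. W (- g + v + g)) (nhds 0)" for g
  proof -
    have "((\<lambda>v. - g + v + g) \<longlongrightarrow> - g + 0 + g) (nhds 0)"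
      by (intro tendsto_add tendsto_const filterlim_ident)
    then show ?thesis using W unfolding filterlim_iff by simp
  qed
  then have "eventually (\<lambda>v. \<forall>g\<in>F. W (- g + v + g)) (nhds 0)"
    using F(1) by (simp add: eventually_ball_finite)
  then show ?thesis
  proof eventually_elim
    case (elim v)
    show ?case
    proof
      fix x
      \<comment> \<open>The cover by left translates of \<open>- W\<close> is applied to
        \<open>- x\<close>, which puts \<open>x + g\<close> into W.\<close>
      obtain g where g: "g \<in> F" "W (- (- g + - x))" using F(2) by blast
      then have "W (x + g)" by (simp add: minus_add)
      then have "U ((x + g) + (- g + v + g) - (x + g))" using elim g(1) WU by blast
      moreover have "(x + g) + (- g + v + g) - (x + g) = x + v - x"
        by (simp add: diff_conv_add_uminus add.assoc minus_add del: add_uminus_conv_diff)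
      ultimately show "U (x + v - x)" by simp
    qed
  qed
qed

text \<open>The conjugators \<open>g t\<close> may vary arbitrarily, since one neighbourhood of 0
  serves all of them at once.\<close>

lemma precompact_group_tendsto_conj:
  fixes s :: "'b \<Rightarrow> 'a::topological_group_add"
  assumes "precompact_group TYPE('a)" "(s \<longlongrightarrow> 0) H"
  shows "((\<lambda>t. g t + s t - g t) \<longlongrightarrow> 0) H"
  unfolding filterlim_iff
proof (intro allI impI)
  fix U :: "'a \<Rightarrow> bool" assume "eventually U (nhds 0)"
  then have "eventually (\<lambda>v. \<forall>g. U (g + v - g)) (nhds 0)"
    by (rule precompact_group_conj_small[OF assms(1)])
  then have "eventually (\<lambda>t. \<forall>g. U (g + s t - g)) H"
    using assms(2) unfolding filterlim_iff by blast
  then show "eventually (\<lambda>t. U (g t + s t - g t)) H" by eventually_elim blast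
qed

text \<open>An ultrafilter contains one of the finitely many translates g + V covering the group,
  and g cancels in the left difference of two elements of g + V.\<close>

lemma precompact_group_ultrafilter_cauchy:
  fixes F :: "'a::topological_group_add filter"
  assumes "precompact_group TYPE('a)" "ultrafilter F"
  shows "left_cauchy F"
  unfolding left_cauchy_def filterlim_iff
proof (intro allI impI)
  fix U :: "'a \<Rightarrow> bool" assume U: "eventually U (nhds 0)"
  have "((\<lambda>(x, y). - x + y) \<longlongrightarrow> - (0::'a) + 0) (nhds 0 \<times>\<^sub>F nhds 0)"
    unfolding case_prod_unfold by (rule tendsto_add tendsto_minus filterlim_projs)+
  then have "eventually (\<lambda>(x, y). U (- x + y)) (nhds 0 \<times>\<^sub>F nhds 0)"
    using U unfolding filterlim_iff by (auto simp: case_prod_unfold)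
  then obtain V where V: "eventually V (nhds 0)" "\<And>x y. \<lbrakk>V x; V y\<rbrakk> \<Longrightarrow> U (- x + y)"
    unfolding eventually_prod_same by auto
  obtain S where S: "finite S" "\<And>x. \<exists>g\<in>S. V (- g + x)"
    using precompact_groupD[OF assms(1) V(1)] by blast
  obtain g where g: "eventually (\<lambda>x. V (- g + x)) F"
    using ultrafilter_eventually_ex_finite[OF assms(2) S(1), of "\<lambda>g x. V (- g + x)"] S(2) by auto
  have "U (- x + y)" if "V (- g + x)" "V (- g + y)" for x y
    using V(2)[OF that]
    by (simp add: diff_conv_add_uminus add.assoc minus_add del: add_uminus_conv_diff)
  then show "eventually (\<lambda>p. U (case p of (x, y) \<Rightarrow> - x + y)) (F \<times>\<^sub>F F)"
    using g unfolding eventually_prod_same by auto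
qed

section \<open>The operation on minimal Cauchy filters\<close>

definition maltsev_filter :: "'a::group_add filter \<Rightarrow> 'a filter \<Rightarrow> 'a filter \<Rightarrow> 'a filter" where
  "maltsev_filter F G H = filtermap (\<lambda>(x, y, z). group_maltsev x y z) (F \<times>\<^sub>F G \<times>\<^sub>F H)"

lemma precompact_group_maltsev_filter:
  fixes F G H :: "'a::topological_group_add filter"
  assumes pre: "precompact_group TYPE('a)"
    and F: "F \<in> min_cauchy" and G: "G \<in> min_cauchy" and H: "H \<in> min_cauchy"
  shows "maltsev_filter F G H \<in> min_cauchy"
proof -
  let ?K = "F \<times>\<^sub>F G \<times>\<^sub>F H"
  have c: "left_cauchy F" "left_cauchy G" "left_cauchy H"
    using F G H unfolding min_cauchy_def by auto
  let ?x = "\<lambda>t::('a\<times>'a\<times>'a)\<times>('a\<times>'a\<times>'a). fst (fst t)" and ?x' = "\<lambda>t. fst (snd t)"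
  let ?y = "\<lambda>t::('a\<times>'a\<times>'a)\<times>('a\<times>'a\<times>'a). fst (snd (fst t))" and ?y' = "\<lambda>t. fst (snd (snd t))"
  let ?z = "\<lambda>t::('a\<times>'a\<times>'a)\<times>('a\<times>'a\<times>'a). snd (snd (fst t))" and ?z' = "\<lambda>t. snd (snd (snd t))"
  have x: "((\<lambda>t. - ?x t + ?x' t) \<longlongrightarrow> 0) (?K \<times>\<^sub>F ?K)"
    by (rule left_cauchy_tendsto[OF c(1)] filterlim_projs)+
  have y: "((\<lambda>t. - ?y' t + ?y t) \<longlongrightarrow> 0) (?K \<times>\<^sub>F ?K)"
    by (rule left_cauchy_tendsto[OF c(2)] filterlim_projs)+
  have z: "((\<lambda>t. - ?z t + ?z' t) \<longlongrightarrow> 0) (?K \<times>\<^sub>F ?K)"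
    by (rule left_cauchy_tendsto[OF c(3)] filterlim_projs)+
  note conj = precompact_group_tendsto_conj[OF pre]
  \<comment> \<open>\<open>- (x - y + z) + (x' - y' + z')\<close> is a sum of conjugates of \<open>- x + x'\<close> and \<open>- y' + y\<close>, plus \<open>- z + z'\<close>.\<close>
  have "((\<lambda>t. (?y t + (- ?x t + ?x' t) - ?y t) + (?y t + (- ?y' t + ?y t) - ?y t)) \<longlongrightarrow> 0 + 0) (?K \<times>\<^sub>F ?K)"
    by (intro tendsto_add conj x y)
  then have "((\<lambda>t. (?y t + (- ?x t + ?x' t) - ?y t) + (?y t + (- ?y' t + ?y t) - ?y t)) \<longlongrightarrow> 0) (?K \<times>\<^sub>F ?K)"
    by (simp only: add_0)
  from tendsto_add[OF conj[OF this, of "\<lambda>t. - ?z t"] z]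
  have "left_cauchy (maltsev_filter F G H)"
    unfolding maltsev_filter_def left_cauchy_filtermap case_prod_unfold group_maltsev_def
    by (simp add: diff_conv_add_uminus add.assoc minus_add del: add_uminus_conv_diff)
  \<comment> \<open>Since \<open>x - y + (z + v) = (x - y + z) + v\<close>, the small term is
    absorbed by the third argument, and the inclusion reduces to
    \<open>thicken H \<le> H\<close>.\<close>
  moreover have "thicken (maltsev_filter F G H) \<le> maltsev_filter F G H"
  proof -
    have "filterlim (\<lambda>(x, v). x + v) H (H \<times>\<^sub>F nhds 0)"
      using H unfolding min_cauchy_def thicken_def filterlim_def by blast
    moreover have "filterlim (\<lambda>t. (snd (snd (fst t)), snd t)) (H \<times>\<^sub>F nhds 0) (?K \<times>\<^sub>F nhds 0)"
      by (rule filterlim_Pair filterlim_projs)+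
    ultimately have "filterlim (\<lambda>t. snd (snd (fst t)) + snd t) H (?K \<times>\<^sub>F nhds 0)"
      using filterlim_compose by fastforce
    then have "filterlim (\<lambda>t. (fst (fst t), fst (snd (fst t)), snd (snd (fst t)) + snd t)) ?K (?K \<times>\<^sub>F nhds 0)"
      by - (rule filterlim_Pair filterlim_projs | assumption)+
    then have "filtermap (\<lambda>(x, y, z). group_maltsev x y z)
       (filtermap (\<lambda>t. (fst (fst t), fst (snd (fst t)), snd (snd (fst t)) + snd t)) (?K \<times>\<^sub>F nhds 0))
      \<le> maltsev_filter F G H"
      unfolding maltsev_filter_def filterlim_def by (rule filtermap_mono)
    then show ?thesis
      unfolding maltsev_filter_def thicken_def prod_filtermap1 filtermap_filtermap
      by (simp add: case_prod_unfold group_maltsev_def add.assoc)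
  qed
  moreover have "maltsev_filter F G H \<noteq> bot"
    using F G H unfolding maltsev_filter_def min_cauchy_def
    by (simp add: filtermap_bot_iff prod_filter_eq_bot)
  ultimately show ?thesis unfolding min_cauchy_def by blast
qed

text \<open>Continuity only makes the image filter finer than the neighbourhood filter; equality
  follows because both are minimal Cauchy.\<close>

lemma maltsev_filter_nhds:
  fixes x y z :: "'a::topological_group_add"
  assumes "precompact_group TYPE('a)"
  shows "maltsev_filter (nhds x) (nhds y) (nhds z) = nhds (group_maltsev x y z)"
proof (rule min_cauchy_eqI)
  show mem: "maltsev_filter (nhds x) (nhds y) (nhds z) \<in> min_cauchy"
    by (intro precompact_group_maltsev_filter assms nhds_min_cauchy)
  show "nhds (group_maltsev x y z) \<in> min_cauchy" by (rule nhds_min_cauchy)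
  have "((\<lambda>(x, y, z). group_maltsev x y z) \<longlongrightarrow> group_maltsev x y z) (nhds x \<times>\<^sub>F nhds y \<times>\<^sub>F nhds z)"
    unfolding case_prod_unfold
    by (rule tendsto_group_maltsev filterlim_projs)+
  then have "maltsev_filter (nhds x) (nhds y) (nhds z) \<le> nhds (group_maltsev x y z)"
    unfolding maltsev_filter_def filterlim_def .
  then show "inf (maltsev_filter (nhds x) (nhds y) (nhds z)) (nhds (group_maltsev x y z)) \<noteq> bot"
    using min_cauchy_not_bot[OF mem] by (simp add: inf_absorb1)
qed

subsection \<open>The compact extension\<close>

text \<open>The sets of all minimal Cauchy filters containing a given set form a base. This is the
  topology of the completion for the left uniformity.\<close>

definition cauchy_topology :: "'a::topological_group_add filter topology" where
  "cauchy_topology = topology (\<lambda>U. U \<subseteq> min_cauchy \<and>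
     (\<forall>F\<in>U. \<exists>P. eventually P F \<and> {G \<in> min_cauchy. eventually P G} \<subseteq> U))"

lemma openin_cauchy_topology:
  "openin cauchy_topology U \<longleftrightarrow> U \<subseteq> min_cauchy \<and>
     (\<forall>F\<in>U. \<exists>P. eventually P F \<and> {G \<in> min_cauchy. eventually P G} \<subseteq> U)"
proof -
  have "istopology (\<lambda>U. U \<subseteq> (min_cauchy :: 'a filter set) \<and>
     (\<forall>F\<in>U. \<exists>P. eventually P F \<and> {G \<in> min_cauchy. eventually P G} \<subseteq> U))"
    unfolding istopology_def
  proof (intro conjI allI impI; (elim conjE)?)
    fix S T :: "'a filter set"
    assume S: "\<forall>F\<in>S. \<exists>P. eventually P F \<and> {G \<in> min_cauchy. eventually P G} \<subseteq> S"
      and T: "\<forall>F\<in>T. \<exists>P. eventually P F \<and> {G \<in> min_cauchy. eventually P G} \<subseteq> T"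
    show "\<forall>F\<in>S \<inter> T. \<exists>P. eventually P F \<and> {G \<in> min_cauchy. eventually P G} \<subseteq> S \<inter> T"
    proof
      fix F assume "F \<in> S \<inter> T"
      then obtain P Q where "eventually P F" "{G \<in> min_cauchy. eventually P G} \<subseteq> S"
        "eventually Q F" "{G \<in> min_cauchy. eventually Q G} \<subseteq> T"
        using S T by blast
      then show "\<exists>P. eventually P F \<and> {G \<in> min_cauchy. eventually P G} \<subseteq> S \<inter> T"
        by (intro exI[of _ "\<lambda>x. P x \<and> Q x"]) (auto simp: eventually_conj_iff)
    qed
  next
    fix K :: "'a filter set set"
    assume K: "\<forall>U\<in>K. U \<subseteq> min_cauchy \<and>
      (\<forall>F\<in>U. \<exists>P. eventually P F \<and> {G \<in> min_cauchy. eventually P G} \<subseteq> U)"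
    show "\<forall>F\<in>\<Union>K. \<exists>P. eventually P F \<and> {G \<in> min_cauchy. eventually P G} \<subseteq> \<Union>K"
    proof
      fix F assume "F \<in> \<Union>K"
      then obtain U where "U \<in> K" "F \<in> U" by blast
      with K show "\<exists>P. eventually P F \<and> {G \<in> min_cauchy. eventually P G} \<subseteq> \<Union>K"
        by (meson Union_upper order_trans)
    qed
  qed auto
  then show ?thesis unfolding cauchy_topology_def by (simp add: topology_inverse')
qed

lemma openin_cauchy_basic: "openin cauchy_topology {G \<in> min_cauchy. eventually P G}"
  unfolding openin_cauchy_topology by blast

lemma topspace_cauchy_topology: "topspace cauchy_topology = min_cauchy"
proof
  show "topspace cauchy_topology \<subseteq> min_cauchy"
    using openin_topspace[of cauchy_topology] unfolding openin_cauchy_topology by blast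
  have "min_cauchy \<subseteq> {G \<in> min_cauchy. eventually (\<lambda>_. True) G}" by simp
  then show "min_cauchy \<subseteq> topspace cauchy_topology"
    using openin_subset[OF openin_cauchy_basic] by fast
qed

text \<open>Distinct minimal Cauchy filters have no proper common refinement, so they contain
  disjoint sets, and no proper filter contains both of these.\<close>

lemma Hausdorff_space_cauchy_topology: "Hausdorff_space cauchy_topology"
  unfolding Hausdorff_space_def topspace_cauchy_topology
proof (intro allI impI, elim conjE)
  fix F G :: "'a filter" assume FG: "F \<in> min_cauchy" "G \<in> min_cauchy" "F \<noteq> G"
  then have "eventually (\<lambda>_. False) (inf F G)"
    using min_cauchy_eqI eventually_False by blast
  then obtain P Q where PQ: "eventually P F" "eventually Q G" "\<And>x. P x \<Longrightarrow> Q x \<Longrightarrow> False"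
    unfolding eventually_inf by blast
  have "disjnt {G \<in> min_cauchy. eventually P G} {G \<in> min_cauchy. eventually Q G}"
    unfolding disjnt_iff
  proof (intro allI notI)
    fix H assume "H \<in> {G \<in> min_cauchy. eventually P G} \<and> H \<in> {G \<in> min_cauchy. eventually Q G}"
    then have "H \<noteq> bot" "eventually (\<lambda>x. P x \<and> Q x) H"
      by (auto simp: min_cauchy_not_bot eventually_conj_iff)
    then show False using eventually_happens PQ(3) by blast
  qed
  then show "\<exists>U V. openin cauchy_topology U \<and> openin cauchy_topology V \<and> F \<in> U \<and> G \<in> V \<and> disjnt U V"
    using openin_cauchy_basic PQ(1,2) FG(1,2) by blast
qed

text \<open>A basic open set given by \<open>P\<close> is shrunk to a set \<open>C\<close> with \<open>P\<close> on a uniform neighbourhood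
  of \<open>C\<close>. The sets \<open>C\<close> meet every ultrafilter, so finitely many cover the group, and thickening them
  back gives a finite subcover.\<close>
lemma compact_space_cauchy_topology:
  assumes "precompact_group TYPE('a::topological_group_add)"
  shows "compact_space (cauchy_topology :: 'a filter topology)"
  unfolding compact_space_alt topspace_cauchy_topology
proof (intro allI impI, elim conjE)
  fix K :: "'a filter set set"
  assume op: "\<forall>U\<in>K. openin cauchy_topology U" and cover: "min_cauchy \<subseteq> \<Union>K"
  define \<C> where "\<C> = {C. \<exists>V U. eventually V (nhds 0) \<and> U \<in> K \<and>
    {G \<in> min_cauchy. eventually (\<lambda>y. \<exists>x v. C x \<and> V v \<and> y = x + v) G} \<subseteq> U}"
  have ultra: "\<exists>C\<in>\<C>. eventually C F" if F: "ultrafilter F" for F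
  proof -
    \<comment> \<open>The ultrafilter itself need not be a point of the space, but its thickening is
      one, so the cover can be applied to it.\<close>
    have "thicken F \<in> min_cauchy"
      by (intro thicken_min_cauchy ultrafilter_not_bot precompact_group_ultrafilter_cauchy F assms)
    then obtain U where U: "U \<in> K" "thicken F \<in> U" using cover by blast
    then obtain P where P: "eventually P (thicken F)" "{G \<in> min_cauchy. eventually P G} \<subseteq> U"
      using op unfolding openin_cauchy_topology by blast
    obtain C V where CV: "eventually C F" "eventually V (nhds 0)" "\<forall>x v. C x \<longrightarrow> V v \<longrightarrow> P (x + v)"
      using P(1) unfolding eventually_thicken by blast
    have "{G \<in> min_cauchy. eventually (\<lambda>y. \<exists>x v. C x \<and> V v \<and> y = x + v) G}
        \<subseteq> {G \<in> min_cauchy. eventually P G}"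
      using CV(3) by (auto elim!: eventually_mono)
    then have "C \<in> \<C>" unfolding \<C>_def using CV(2) P(2) U(1) by blast
    with CV(1) show ?thesis by blast
  qed
  have "\<exists>S. finite S \<and> S \<subseteq> \<C> \<and> (\<forall>x. \<exists>C\<in>S. C x)"
  proof (rule ccontr)
    assume neg: "\<not> ?thesis"
    \<comment> \<open>If no finite subfamily of \<open>\<C>\<close> covers the group, the
      complements generate a proper filter, and an ultrafilter finer than it contradicts
      \<open>ultra\<close>.\<close>
    have "(INF C\<in>\<C>. principal {x. \<not> C x}) \<noteq> bot"
    proof (rule INF_filter_not_bot)
      fix S assume S: "S \<subseteq> \<C>" "finite S"
      with neg[unfolded not_ex, rule_format, of S] obtain x where x: "\<forall>C\<in>S. \<not> C x" by auto
      then have "principal {x} \<le> (INF C\<in>S. principal {x. \<not> C x})"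
        by (auto intro!: INF_greatest)
      then show "(INF C\<in>S. principal {x. \<not> C x}) \<noteq> bot"
        by (metis bot.extremum_uniqueI insert_not_empty principal_eq_bot_iff)
    qed
    then obtain F where F: "ultrafilter F" "F \<le> (INF C\<in>\<C>. principal {x. \<not> C x})"
      using ex_ultrafilter_le by blast
    obtain C where C: "C \<in> \<C>" "eventually C F" using ultra[OF F(1)] by blast
    have "F \<le> principal {x. \<not> C x}" using F(2) C(1) by (meson INF_lower order_trans)
    then have "eventually (\<lambda>x. \<not> C x) F" by (simp add: le_principal)
    with C(2) have "eventually (\<lambda>x. False) F" by eventually_elim blast
    then show False using ultrafilter_not_bot[OF F(1)] by (simp add: eventually_False)
  qed
  then obtain S where S: "finite S" "S \<subseteq> \<C>" "\<And>x. \<exists>C\<in>S. C x" by blast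
  have "\<forall>C\<in>S. \<exists>V U. eventually V (nhds 0) \<and> U \<in> K \<and>
      {G \<in> min_cauchy. eventually (\<lambda>y. \<exists>x v. C x \<and> V v \<and> y = x + v) G} \<subseteq> U"
    using S(2) unfolding \<C>_def by auto
  from bchoice[OF this] obtain V where "\<forall>C\<in>S. \<exists>U. eventually (V C) (nhds 0) \<and> U \<in> K \<and>
      {G \<in> min_cauchy. eventually (\<lambda>y. \<exists>x v. C x \<and> V C v \<and> y = x + v) G} \<subseteq> U" ..
  from bchoice[OF this] obtain u where u: "\<forall>C\<in>S. eventually (V C) (nhds 0) \<and> u C \<in> K \<and>
      {G \<in> min_cauchy. eventually (\<lambda>y. \<exists>x v. C x \<and> V C v \<and> y = x + v) G} \<subseteq> u C" ..
  have "G \<in> \<Union>(u ` S)" if G: "G \<in> min_cauchy" for G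
  proof -
    \<comment> \<open>\<open>G\<close> need not contain any C from S, but a finer ultrafilter does;
      as \<open>G\<close> is the thickening of that ultrafilter, it contains C + V C.\<close>
    obtain F where F: "ultrafilter F" "F \<le> G" using ex_ultrafilter_le[OF min_cauchy_not_bot[OF G]] by blast
    obtain C where C: "C \<in> S" "eventually C F"
      using ultrafilter_eventually_ex_finite[OF F(1) S(1), of "\<lambda>C. C"] S(3) by auto
    have "eventually (\<lambda>y. \<exists>x v. C x \<and> V C v \<and> y = x + v) (thicken F)"
      unfolding eventually_thicken using C u by blast
    then show ?thesis
      using min_cauchy_eq_thicken[OF G ultrafilter_not_bot[OF F(1)] F(2)] G C(1) u by blast
  qed
  then show "\<exists>\<F>. finite \<F> \<and> \<F> \<subseteq> K \<and> min_cauchy \<subseteq> \<Union>\<F>"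
    using S(1) u by (intro exI[of _ "u ` S"]) auto
qed

section \<open>The group as a dense subspace\<close>

lemma embedding_map_nhds:
  "embedding_map (euclidean :: 'a::{topological_group_add, t2_space} topology) cauchy_topology nhds"
proof -
  have "continuous_map (euclidean :: 'a topology) cauchy_topology nhds"
    unfolding continuous_map_def topspace_cauchy_topology
  proof (intro conjI allI impI)
    fix U :: "'a filter set" assume U: "openin cauchy_topology U"
    have "open {x::'a. nhds x \<in> U}"
      unfolding open_subopen[of "{x::'a. nhds x \<in> U}"]
    proof (intro ballI)
      fix x :: 'a assume "x \<in> {x. nhds x \<in> U}"
      then obtain P where P: "eventually P (nhds x)" "{G \<in> min_cauchy. eventually P G} \<subseteq> U"
        using U unfolding openin_cauchy_topology by blast
      obtain S where S: "open S" "x \<in> S" "\<forall>y\<in>S. P y" using P(1) unfolding eventually_nhds by blast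
      have "nhds y \<in> U" if "y \<in> S" for y
      proof -
        have "eventually P (nhds y)" unfolding eventually_nhds using S(1,3) that by (intro exI[of _ S]) auto
        then show ?thesis using P(2) nhds_min_cauchy[of y] by auto
      qed
      with S show "\<exists>T. open T \<and> x \<in> T \<and> T \<subseteq> {x. nhds x \<in> U}" by blast
    qed
    then show "openin euclidean {x \<in> topspace euclidean. nhds x \<in> U}" by simp
  qed (auto simp: nhds_min_cauchy)
  moreover have "inj (nhds :: 'a \<Rightarrow> 'a filter)"
  proof (rule injI, rule ccontr)
    fix x y :: 'a assume eq: "nhds x = nhds y" and "x \<noteq> y"
    then obtain U V where UV: "open U" "open V" "x \<in> U" "y \<in> V" "U \<inter> V = {}"
      by (meson hausdorff)
    then have "eventually (\<lambda>z. z \<in> U) (nhds y)" unfolding eq[symmetric] by (simp add: eventually_nhds_in_open)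
    from eventually_nhds_x_imp_x[OF this] show False using UV by blast
  qed
  moreover have "open_map (euclidean :: 'a topology) (subtopology cauchy_topology (range nhds)) nhds"
    unfolding open_map_def
  proof (intro allI impI)
    fix U :: "'a set" assume "openin euclidean U"
    \<comment> \<open>An open set belongs to the neighbourhood filter of a point exactly when it
      contains the point, so the image of U is the trace of a basic open set.\<close>
    then have "nhds ` U = {G \<in> min_cauchy. eventually (\<lambda>x. x \<in> U) G} \<inter> range nhds"
      using eventually_nhds_x_imp_x
      by (auto simp: nhds_min_cauchy eventually_nhds_in_open)
    then show "openin (subtopology cauchy_topology (range nhds)) (nhds ` U)"
      unfolding openin_subtopology using openin_cauchy_basic by blast
  qed
  ultimately show ?thesis
    unfolding embedding_map_def
    by (intro bijective_open_imp_homeomorphic_map)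
       (auto simp: continuous_map_in_subtopology topspace_cauchy_topology nhds_min_cauchy)
qed

text \<open>It remains to show density. A set P in \<open>F\<close> contains some C + V with C in
  \<open>F\<close>; for any x in C it is then a neighbourhood of x, so \<open>nhds x\<close> lies in
  the basic open set given by P.\<close>

lemma compact_extension_nhds:
  assumes "precompact_group TYPE('a::{topological_group_add, t2_space})"
  shows "compact_extension (euclidean :: 'a topology) cauchy_topology nhds"
proof -
  have "F \<in> cauchy_topology closure_of (range nhds)" if F: "F \<in> min_cauchy" for F :: "'a filter"
    unfolding in_closure_of topspace_cauchy_topology
  proof (intro conjI allI impI F; elim conjE)
    fix U assume "F \<in> U" "openin cauchy_topology U"
    then obtain P where P: "eventually P F" "{G \<in> min_cauchy. eventually P G} \<subseteq> U"
      unfolding openin_cauchy_topology by blast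
    then have "eventually P (thicken F)"
      using F filter_leD unfolding min_cauchy_def by blast
    then obtain C V where CV: "eventually C F" "eventually V (nhds 0)" "\<forall>x v. C x \<longrightarrow> V v \<longrightarrow> P (x + v)"
      unfolding eventually_thicken by blast
    obtain x where "C x" using CV(1) min_cauchy_not_bot[OF F] eventually_happens by blast
    have "((\<lambda>y. - x + y) \<longlongrightarrow> - x + x) (nhds x)"
      by (intro tendsto_add tendsto_const filterlim_ident)
    then have "eventually (\<lambda>y. V (- x + y)) (nhds x)" using CV(2) unfolding filterlim_iff by simp
    then have "eventually P (nhds x)"
    proof eventually_elim
      case (elim y)
      then show ?case using CV(3) \<open>C x\<close> by (metis add_minus_cancel)
    qed
    then show "\<exists>y. y \<in> range nhds \<and> y \<in> U" using P(2) nhds_min_cauchy by blast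
  qed
  then have "cauchy_topology closure_of (range nhds) = (min_cauchy :: 'a filter set)"
    using closure_of_subset_topspace[of cauchy_topology] unfolding topspace_cauchy_topology by blast
  then show ?thesis
    unfolding compact_extension_def
    by (simp add: compact_space_cauchy_topology assms Hausdorff_space_cauchy_topology
        embedding_map_nhds topspace_cauchy_topology)
qed

text \<open>That P belongs to the image filter is witnessed by members A, B, C of the three filters,
  and the same A, B, C serve every triple of filters containing them. Such triples form an open
  box.\<close>

lemma continuous_ternary_maltsev_filter:
  assumes "precompact_group TYPE('a::topological_group_add)"
  shows "continuous_ternary (cauchy_topology :: 'a filter topology) maltsev_filter"
  unfolding continuous_ternary_def continuous_map_def
proof (intro conjI allI impI)
  show "(\<lambda>(F, G, H). maltsev_filter F G H)
      \<in> topspace (cube_topology (cauchy_topology :: 'a filter topology)) \<rightarrow> topspace cauchy_topology"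
    unfolding cube_topology_def topspace_cauchy_topology topspace_prod_topology
    using precompact_group_maltsev_filter[OF assms] by auto
  fix U :: "'a filter set" assume U: "openin cauchy_topology U"
  let ?W = "{t \<in> topspace (cube_topology cauchy_topology). (\<lambda>(F, G, H). maltsev_filter F G H) t \<in> U}"
  show "openin (cube_topology cauchy_topology) ?W"
    unfolding openin_subopen[of _ ?W]
  proof
    fix t assume "t \<in> ?W"
    then obtain F G H where t: "t = (F, G, H)" and mem: "F \<in> min_cauchy" "G \<in> min_cauchy" "H \<in> min_cauchy"
      and "maltsev_filter F G H \<in> U"
      unfolding cube_topology_def topspace_prod_topology topspace_cauchy_topology by auto
    then obtain P where P: "eventually P (maltsev_filter F G H)" "{G \<in> min_cauchy. eventually P G} \<subseteq> U"
      using U unfolding openin_cauchy_topology by blast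
    then obtain A E where A: "eventually A F" and E: "eventually E (G \<times>\<^sub>F H)"
      and AE: "\<And>x y z. \<lbrakk>A x; E (y, z)\<rbrakk> \<Longrightarrow> P (group_maltsev x y z)"
      unfolding maltsev_filter_def eventually_filtermap eventually_prod_filter[of _ F "G \<times>\<^sub>F H"]
      by auto
    from E obtain B C where B: "eventually B G" and C: "eventually C H"
      and BC: "\<And>y z. \<lbrakk>B y; C z\<rbrakk> \<Longrightarrow> E (y, z)"
      unfolding eventually_prod_filter by blast
    let ?N = "\<lambda>P. {G \<in> min_cauchy. eventually P (G :: 'a filter)}"
    have "maltsev_filter F' G' H' \<in> U" if "F' \<in> ?N A" "G' \<in> ?N B" "H' \<in> ?N C" for F' G' H'
    proof -
      have "eventually E (G' \<times>\<^sub>F H')"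
        using that BC unfolding eventually_prod_filter by blast
      then have "eventually P (maltsev_filter F' G' H')"
        unfolding maltsev_filter_def eventually_filtermap eventually_prod_filter[of _ F' "G' \<times>\<^sub>F H'"]
        using that(1) AE by (intro exI[of _ A] exI[of _ E]) auto
      then show ?thesis
        using precompact_group_maltsev_filter[OF assms] that P(2) by blast
    qed
    then have "?N A \<times> ?N B \<times> ?N C \<subseteq> ?W"
      unfolding cube_topology_def topspace_prod_topology topspace_cauchy_topology by auto
    moreover have "openin (cube_topology cauchy_topology) (?N A \<times> ?N B \<times> ?N C)"
      unfolding cube_topology_def openin_prod_Times_iff using openin_cauchy_basic by blast
    moreover have "t \<in> ?N A \<times> ?N B \<times> ?N C" using t mem A B C by simp
    ultimately show "\<exists>T. openin (cube_topology cauchy_topology) T \<and> t \<in> T \<and> T \<subseteq> ?W" by blast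
  qed
qed

theorem proposition5:
  "strongly_rectifiable (euclidean :: 'a::{topological_group_add, t2_space} topology) \<and>
   (precompact_group TYPE('a) \<longrightarrow> precompact_strongly_rectifiable (euclidean :: 'a topology))"
proof (intro conjI impI)
  show "strongly_rectifiable (euclidean :: 'a topology)"
    unfolding strongly_rectifiable_def using strong_maltsev_group_maltsev by blast
  assume pre: "precompact_group TYPE('a)"
  have "extends_to (euclidean :: 'a topology) group_maltsev cauchy_topology nhds"
    unfolding extends_to_def
    using continuous_ternary_maltsev_filter[OF pre] maltsev_filter_nhds[OF pre] by blast
  \<comment> \<open>The points of this extension have type \<open>'a filter\<close>;
    \<open>precompact_operationI\<close> transfers it to the type \<open>'a set set\<close>.\<close>
  then have "precompact_operation (euclidean :: 'a topology) group_maltsev"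
    using precompact_operationI compact_extension_nhds[OF pre] strong_maltsev_group_maltsev
    unfolding strong_maltsev_operation_def by blast
  then show "precompact_strongly_rectifiable (euclidean :: 'a topology)"
    unfolding precompact_strongly_rectifiable_def using strong_maltsev_group_maltsev by blast
qed

end
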